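(* Let $d\ge 1$, let $f$ be a uniformly continuous probability density on $\mathbb{R}^d$, let $X_1,X_2,\dots$ be i.i.d. with density $f$, and let $\mathcal{X}_n=\{X_1,\dots,X_n\}$. Let $r>0$ be fixed and put $N=n\,\omega\, r^d$. Then almost surely, $$\frac1N\,\mathrm{C}_{r}(x,\mathcal{X}_n)\xrightarrow[n\to\infty]{}\mathrm{C}_r(x,f)\quad\text{uniformly in } x\in\mathbb{R}^d .$$
   Context: $\mathsf{B}(x,r)$ is the closed Euclidean ball of center $x$ and radius $r$, and $\omega$ is the volume of the unit ball of $\mathbb{R}^d$. Discrete coreness: for $x\in\mathbb{R}^d$ and $r>0$, $\mathcal{G}_r(x,\mathcal{X}_n)$ is the (undirected, simple) graph with vertex set $\{x\}\cup\mathcal{X}_n$ in which two distinct points are adjacent iff their Euclidean distance is at most $r$. $\mathrm{C}_r(x,\mathcal{X}_n)$ is the largest integer $\ell$ such that there is a subgraph $H$ of $\mathcal{G}_r(x,\mathcal{X}_n)$ containing the vertex $x$ with $\min_{v\in H}\deg_H(v)\ge \ell$. Continuum $r$-coreness: for $r>0$ and a non-negative bounded measurable $\phi:\mathbb{R}^d\to\mathbb{R}$, let $$\mathrm{H}_r\phi(x)=\sup\Big\{t\ge0 : \frac1{\omega r^d}\int_{\mathsf{B}(x,r)}\mathbf{1}_{\phi(z)\ge t}\,f(z)\,dz\ge t\Big\},$$ let $\mathrm{H}_r^k$ be its $k$-th iterate, and let $f_r(x)=\frac{1}{\omega r^d}\int_{\mathsf{B}(x,r)}f(z)\,dz$. Then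 $\mathrm{C}_r(x,f)=\lim_{k\to\infty}\mathrm{H}_r^kf_r(x)$ (this limit exists). *)

theory Defs
  imports "HOL-Probability.Probability"
begin

text \<open>A simple graph is a pair of a vertex set and a set of edges, each edge being a
  two-element set of vertices. Subgraphs need not be induced.\<close>

type_synonym 'a graph = "'a set \<times> 'a set set"

definition neighborhood_graph :: "real \<Rightarrow> 'a::metric_space \<Rightarrow> 'a set \<Rightarrow> 'a graph" where
  "neighborhood_graph r x A =
     (insert x A, {{u, v} |u v. u \<in> insert x A \<and> v \<in> insert x A \<and> u \<noteq> v \<and> dist u v \<le> r})"

definition is_subgraph :: "'a graph \<Rightarrow> 'a graph \<Rightarrow> bool" where
  "is_subgraph H G \<longleftrightarrow> fst H \<subseteq> fst G \<and> snd H \<subseteq> snd G \<and> (\<forall>e\<in>snd H. e \<subseteq> fst H)"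

definition graph_degree :: "'a graph \<Rightarrow> 'a \<Rightarrow> nat" where
  "graph_degree H v = card {e \<in> snd H. v \<in> e}"

definition core_levels :: "real \<Rightarrow> 'a::metric_space \<Rightarrow> 'a set \<Rightarrow> nat set" where
  "core_levels r x A =
     {l. \<exists>H. is_subgraph H (neighborhood_graph r x A) \<and> x \<in> fst H \<and>
             l \<le> Min (graph_degree H ` fst H)}"

definition discrete_coreness :: "real \<Rightarrow> 'a::metric_space \<Rightarrow> 'a set \<Rightarrow> nat" where
  "discrete_coreness r x A = Max (core_levels r x A)"

text \<open>For a finite point set the maximum is taken over a finite nonempty set.\<close>

lemma zero_in_core_levels: "0 \<in> core_levels r x A"
  unfolding core_levels_def
  by (rule CollectI, rule exI[of _ "({x}, {})"])
     (auto simp: is_subgraph_def neighborhood_graph_def)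

lemma finite_core_levels:
  assumes "finite A"
  shows "finite (core_levels r x A)"
proof -
  let ?G = "neighborhood_graph r x A"
  have finE: "finite (snd ?G)"
    by (rule finite_subset[of _ "Pow (insert x A)"])
       (use assms in \<open>auto simp: neighborhood_graph_def\<close>)
  have "l \<le> card (snd ?G)" if "l \<in> core_levels r x A" for l
  proof -
    from that obtain H where H: "is_subgraph H ?G" "x \<in> fst H"
        "l \<le> Min (graph_degree H ` fst H)"
      by (auto simp: core_levels_def)
    have "finite (fst H)"
      using H(1) assms by (auto simp: is_subgraph_def neighborhood_graph_def intro: finite_subset)
    hence "l \<le> graph_degree H x"
      using H by (meson Min_le finite_imageI imageI order_trans)
    also have "\<dots> \<le> card (snd ?G)"
      unfolding graph_degree_def using H(1) finE
      by (intro card_mono) (auto simp: is_subgraph_def)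
    finally show ?thesis .
  qed
  thus ?thesis
    by (meson finite_nat_set_iff_bounded_le)
qed

definition unit_ball_volume :: "'a::euclidean_space itself \<Rightarrow> real" where
  "unit_ball_volume _ = measure lborel (cball (0::'a) 1)"

definition ball_average :: "real \<Rightarrow> ('a::euclidean_space \<Rightarrow> real) \<Rightarrow> 'a \<Rightarrow> real" where
  "ball_average r f x =
     (1 / (unit_ball_volume TYPE('a) * r ^ DIM('a))) * (LINT z:cball x r|lborel. f z)"

definition H_op ::
    "real \<Rightarrow> ('a::euclidean_space \<Rightarrow> real) \<Rightarrow> ('a \<Rightarrow> real) \<Rightarrow> 'a \<Rightarrow> real" where
  "H_op r f \<phi> x =
     Sup {t. 0 \<le> t \<and> ball_average r (\<lambda>z. indicator {z. \<phi> z \<ge> t} z * f z) x \<ge> t}"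

definition continuum_coreness :: "real \<Rightarrow> ('a::euclidean_space \<Rightarrow> real) \<Rightarrow> 'a \<Rightarrow> real" where
  "continuum_coreness r f x = lim (\<lambda>k. (H_op r f ^^ k) (ball_average r f) x)"

text \<open>For a nonnegative integrable \<open>f\<close>, the supremum in \<open>H_op\<close> is over a nonempty bounded
  set whenever \<open>\<phi>\<close> is measurable, the iterates are measurable, and the limit defining
  \<open>continuum_coreness\<close> exists, so the conventions of \<open>Sup\<close> and \<open>lim\<close> on
  degenerate arguments play no role.\<close>

context
  fixes r :: real and f :: "'a::euclidean_space \<Rightarrow> real"
  assumes int_f: "integrable lborel f" and nonneg_f: "\<And>x. 0 \<le> f x" and r_pos: "0 < r"
begin

private abbreviation "lev \<phi> t \<equiv> ball_average r (\<lambda>z. indicator {z. \<phi> z \<ge> t} z * f z)"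

lemma ball_average_const_nonneg: "0 \<le> 1 / (unit_ball_volume TYPE('a) * r ^ DIM('a))"
  using r_pos by (simp add: unit_ball_volume_def)

lemma integrable_level:
  fixes \<phi> :: "'a \<Rightarrow> real"
  assumes "\<phi> \<in> borel_measurable borel"
  shows "integrable lborel (\<lambda>z. indicator {z. \<phi> z \<ge> t} z * f z)"
proof -
  have "{z \<in> space borel. \<phi> z \<ge> t} \<in> sets borel"
    using assms by measurable
  hence "{z. \<phi> z \<ge> t} \<in> sets lborel" by simp
  from integrable_mult_indicator[OF this int_f] show ?thesis by simp
qed

lemma ball_average_mono:
  fixes g h :: "'a \<Rightarrow> real"
  assumes "integrable lborel g" "integrable lborel h" "\<And>z. g z \<le> h z"
  shows "ball_average r g x \<le> ball_average r h x"
proof -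
  have "(LINT z:cball x r|lborel. g z) \<le> (LINT z:cball x r|lborel. h z)"
    using assms integrable_mult_indicator[of "cball x r" lborel g]
      integrable_mult_indicator[of "cball x r" lborel h]
    by (intro set_integral_mono) (auto simp: set_integrable_def)
  thus ?thesis
    unfolding ball_average_def using ball_average_const_nonneg by (rule mult_left_mono)
qed

lemma ball_average_measurable:
  fixes g :: "'a \<Rightarrow> real"
  assumes "integrable lborel g"
  shows "ball_average r g \<in> borel_measurable borel"
proof -
  have [measurable]: "g \<in> borel_measurable borel"
    using borel_measurable_integrable[OF assms] by simp
  have eq: "(\<lambda>x. LINT z:cball x r|lborel. g z) =
        (\<lambda>x. LINT z|lborel. (if dist x z \<le> r then g z else 0))"
    by (auto simp: set_lebesgue_integral_def indicator_def fun_eq_iff mem_cball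
             intro!: Bochner_Integration.integral_cong)
  have "(\<lambda>x. LINT z|lborel. (if dist x z \<le> r then g z else 0)) \<in> borel_measurable borel"
    by measurable
  hence "(\<lambda>x. LINT z:cball x r|lborel. g z) \<in> borel_measurable borel"
    by (simp only: eq)
  thus ?thesis
    unfolding ball_average_def by (intro borel_measurable_times borel_measurable_const)
qed

lemma H_op_set_props:
  assumes "\<phi> \<in> borel_measurable borel"
  shows "lev \<phi> t x \<le> ball_average r f x"
    and "s \<le> t \<Longrightarrow> lev \<phi> t x \<le> lev \<phi> s x"
    and "0 \<le> lev \<phi> t x"
    and "bdd_above {t. 0 \<le> t \<and> lev \<phi> t x \<ge> t}"
    and "0 \<in> {t. 0 \<le> t \<and> lev \<phi> t x \<ge> t}"
proof -
  show le: "lev \<phi> t x \<le> ball_average r f x" for t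
    by (rule ball_average_mono[OF integrable_level[OF assms] int_f])
       (auto simp: indicator_def nonneg_f)
  show "lev \<phi> t x \<le> lev \<phi> s x" if "s \<le> t"
    by (rule ball_average_mono[OF integrable_level[OF assms] integrable_level[OF assms]])
       (use that in \<open>auto simp: indicator_def nonneg_f\<close>)
  have "ball_average r (\<lambda>_. 0) x \<le> lev \<phi> t x" for t
    by (rule ball_average_mono[OF _ integrable_level[OF assms]])
       (auto simp: indicator_def nonneg_f)
  then show ge: "0 \<le> lev \<phi> t x" for t
    by (simp add: ball_average_def)
  show "bdd_above {t. 0 \<le> t \<and> lev \<phi> t x \<ge> t}"
    by (rule bdd_aboveI[of _ "ball_average r f x"]) (use le in \<open>auto intro: order_trans\<close>)
  show "0 \<in> {t. 0 \<le> t \<and> lev \<phi> t x \<ge> t}"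
    using ge[of 0] by simp
qed

lemma H_op_nonneg: "\<phi> \<in> borel_measurable borel \<Longrightarrow> 0 \<le> H_op r f \<phi> x"
  unfolding H_op_def by (intro cSup_upper H_op_set_props)

lemma H_op_le: 
  assumes "\<phi> \<in> borel_measurable borel"
  shows "H_op r f \<phi> x \<le> ball_average r f x"
  unfolding H_op_def
  by (rule cSup_least) (use H_op_set_props[OF assms] in \<open>blast, auto intro: order_trans\<close>)

lemma H_op_mono:
  assumes "\<phi> \<in> borel_measurable borel" "\<psi> \<in> borel_measurable borel" "\<And>z. \<phi> z \<le> \<psi> z"
  shows "H_op r f \<phi> x \<le> H_op r f \<psi> x"
proof -
  have "lev \<phi> t x \<le> lev \<psi> t x" for t
    by (rule ball_average_mono[OF integrable_level integrable_level])
       (use assms in \<open>auto simp: indicator_def nonneg_f intro: order_trans\<close>)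
  hence "{t. 0 \<le> t \<and> lev \<phi> t x \<ge> t} \<subseteq> {t. 0 \<le> t \<and> lev \<psi> t x \<ge> t}"
    by (auto intro: order_trans)
  thus ?thesis
    unfolding H_op_def
    using H_op_set_props(4)[OF assms(2)] H_op_set_props(5)[OF assms(1)]
    by (intro cSup_subset_mono) blast+
qed

lemma H_op_measurable:
  assumes "\<phi> \<in> borel_measurable borel"
  shows "H_op r f \<phi> \<in> borel_measurable borel"
proof (rule borel_measurableI_greater)
  fix s :: real
  have "s < H_op r f \<phi> x \<longleftrightarrow> s < 0 \<or> (\<exists>q\<in>\<rat>. s < q \<and> 0 \<le> q \<and> q \<le> lev \<phi> q x)" for x
  proof
    assume s: "s < H_op r f \<phi> x"
    show "s < 0 \<or> (\<exists>q\<in>\<rat>. s < q \<and> 0 \<le> q \<and> q \<le> lev \<phi> q x)"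
    proof (cases "s < 0")
      case False
      from s obtain t where t: "0 \<le> t" "t \<le> lev \<phi> t x" "s < t"
        unfolding H_op_def
        using less_cSup_iff[OF _ H_op_set_props(4)[OF assms]] H_op_set_props(5)[OF assms]
        by blast
      obtain q where q: "q \<in> \<rat>" "s < q" "q < t"
        using Rats_dense_in_real[OF t(3)] by blast
      have "lev \<phi> t x \<le> lev \<phi> q x"
        using H_op_set_props(2)[OF assms, of q t] q by simp
      with t q False show ?thesis by force
    qed simp
  next
    assume "s < 0 \<or> (\<exists>q\<in>\<rat>. s < q \<and> 0 \<le> q \<and> q \<le> lev \<phi> q x)"
    thus "s < H_op r f \<phi> x"
    proof
      assume "s < 0"
      with H_op_nonneg[OF assms, of x] show ?thesis by linarith
    next
      assume "\<exists>q\<in>\<rat>. s < q \<and> 0 \<le> q \<and> q \<le> lev \<phi> q x"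
      then obtain q where q: "s < q" "0 \<le> q" "q \<le> lev \<phi> q x" by blast
      have "q \<le> H_op r f \<phi> x"
        unfolding H_op_def by (rule cSup_upper) (use q H_op_set_props(4)[OF assms] in auto)
      with q show ?thesis by linarith
    qed
  qed
  hence eq: "H_op r f \<phi> -` {s<..} \<inter> space borel =
      (if s < 0 then UNIV else (\<Union>q\<in>{q\<in>\<rat>. s < q \<and> 0 \<le> q}. {x. q \<le> lev \<phi> q x}))"
    by auto
  have "{x. q \<le> lev \<phi> q x} \<in> sets borel" for q
    using ball_average_measurable[OF integrable_level[OF assms]] by simp
  moreover have "countable {q::real. q \<in> \<rat> \<and> s < q \<and> 0 \<le> q}"
    by (rule countable_subset[OF _ countable_rat]) auto
  ultimately show "{x \<in> space borel. s < H_op r f \<phi> x} \<in> sets borel"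
    using eq by (auto simp: vimage_def intro!: sets.countable_UN'')
qed

lemma H_op_iterate_measurable: "(H_op r f ^^ k) (ball_average r f) \<in> borel_measurable borel"
  by (induction k) (auto intro: H_op_measurable ball_average_measurable int_f)

lemma H_op_iterate_Suc_le:
  "(H_op r f ^^ Suc k) (ball_average r f) x \<le> (H_op r f ^^ k) (ball_average r f) x"
proof (induction k arbitrary: x)
  case 0
  show ?case using H_op_le[OF ball_average_measurable[OF int_f]] by simp
next
  case (Suc k)
  have "H_op r f ((H_op r f ^^ Suc k) (ball_average r f)) x
      \<le> H_op r f ((H_op r f ^^ k) (ball_average r f)) x"
    by (rule H_op_mono[OF H_op_iterate_measurable H_op_iterate_measurable Suc.IH])
  thus ?case by simp
qed

lemma continuum_coreness_limit:
  "(\<lambda>k. (H_op r f ^^ k) (ball_average r f) x) \<longlonglongrightarrow> continuum_coreness r f x"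
proof -
  let ?a = "\<lambda>k. (H_op r f ^^ k) (ball_average r f) x"
  have "decseq ?a"
    by (rule decseq_SucI) (rule H_op_iterate_Suc_le)
  moreover have "0 \<le> ?a (Suc k)" for k
    using H_op_nonneg[OF H_op_iterate_measurable] by simp
  hence "\<forall>k. 0 \<le> ?a k"
    using H_op_iterate_Suc_le order_trans by blast
  ultimately obtain L where "?a \<longlonglongrightarrow> L"
    by (rule decseq_convergent[of ?a 0]) auto
  thus ?thesis
    unfolding continuum_coreness_def using limI by blast
qed

end

end

theory Submission
  imports Defs
begin

text \<open>Both corenesses are governed by \<^emph>\<open>self-dense\<close> sets, sets each of whose members has a
  prescribed amount of the set within distance \<open>r\<close>. The discrete coreness of \<open>x\<close> is the largest
  \<open>l\<close> for which some vertex set containing \<open>x\<close> has at least \<open>l\<close> neighbours of each of its members.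
  On the continuum side, let \<open>P\<close> be the law with density \<open>f\<close>, \<open>c = 1 / (\<omega> r^d)\<close>, and
  \<open>\<phi> k\<close> the \<open>k\<close>-th iterate of \<open>H\<close> on the ball averages of \<open>f\<close>. The coreness \<open>C\<close> is the
  decreasing limit of the \<open>\<phi> k\<close>, and therefore each of its superlevel sets \<open>A = {z. t \<le> C z}\<close>
  satisfies \<open>c P(B(z, r) \<inter> A) \<ge> t\<close> for all \<open>z \<in> A\<close> (\<open>core_level_self_dense\<close>).

  The two descriptions are compared through the empirical frequencies of the sets
  \<open>B(z, r) \<inter> A\<close>, with \<open>A\<close> fixed and \<open>z\<close> arbitrary. These converge to the corresponding
  probabilities uniformly in \<open>z\<close> (\<open>AE_uniform_freq\<close>): for each \<open>e > 0\<close> finitely many pairs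
  \<open>L \<subseteq> U\<close> with \<open>P(U - L) < e\<close> suffice to enclose all balls of radius \<open>r\<close>. Letting \<open>e\<close> run
  through a null sequence leaves countably many sets, and on each of them Hoeffding's inequality and the Borel-Cantelli lemma give almost sure
  convergence.

  Lower bound: if \<open>t \<le> C x\<close>, the sample points in \<open>{z. t \<le> C z}\<close> together with \<open>x\<close> span a
  subgraph whose degrees are at least about \<open>n t / c\<close>, since the sample points are almost surely
  distinct (\<open>core_ge_imp_discrete_coreness\<close>).

  Upper bound: let \<open>V\<close> be a vertex set that realises the discrete coreness \<open>l\<close> of \<open>x\<close>, and
  let \<open>t\<close> be slightly below \<open>c l / n\<close>. If \<open>V \<subseteq> {z. t \<le> \<phi> j z}\<close>, then each ball centred in \<open>V\<close>
  contains almost \<open>l\<close> sample points of this superlevel set, so it has \<open>c P\<close>-mass at least \<open>t\<close>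
  there, and hence \<open>V \<subseteq> {z. t \<le> \<phi> (j + 1) z}\<close>. The level \<open>t\<close> is the same at each step, so errors do
  not accumulate and \<open>t \<le> \<phi> k x\<close> for every fixed \<open>k\<close>
  (\<open>discrete_coreness_imp_\<phi>_ge\<close>). It remains to know that \<open>\<phi> k\<close> tends to \<open>C\<close> uniformly. This
  follows from the same enclosures: two points whose balls lie between the same \<open>L\<close> and \<open>U\<close> have
  values under \<open>H\<close> that differ by at most \<open>c P(U - L)\<close>, so the iterates only have to be
  controlled at finitely many points.

  For a given tolerance the levels \<open>t\<close> can be taken from a finite grid of rationals. Hence the
  uniform convergence of frequencies is applied to countably many sets \<open>A\<close>, and the exceptional null
  sets can be united.\<close>

section \<open>Discrete coreness through vertex sets\<close>

lemma card_neighbours_eq_card_edges: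
  assumes "\<And>e. e \<in> E \<Longrightarrow> \<exists>u w. e = {u, w} \<and> u \<noteq> w"
  shows "card {e \<in> E. v \<in> e} = card {u. u \<noteq> v \<and> {u, v} \<in> E}"
proof -
  have "bij_betw (\<lambda>u. {u, v}) {u. u \<noteq> v \<and> {u, v} \<in> E} {e \<in> E. v \<in> e}"
  proof (rule bij_betwI')
    fix e assume e: "e \<in> {e \<in> E. v \<in> e}"
    then obtain u w where "e = {u, w}" "u \<noteq> w" "v \<in> e" "e \<in> E"
      using assms by blast
    thus "\<exists>u\<in>{u. u \<noteq> v \<and> {u, v} \<in> E}. e = {u, v}"
      by (auto simp: insert_commute)
  qed (auto simp: doubleton_eq_iff)
  thus ?thesis
    by (simp add: bij_betw_same_card)
qed

text \<open>The induced subgraph on \<open>S\<close> has the largest degrees among the subgraphs with vertex set \<open>S\<close>, so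
  lower bounds for the coreness need no edge sets.\<close>

lemma discrete_coreness_ge:
  fixes x :: "'a::metric_space"
  assumes fin: "finite A" and S: "S \<subseteq> insert x A" "x \<in> S"
    and deg: "\<And>v. v \<in> S \<Longrightarrow> l \<le> card {u \<in> S. u \<noteq> v \<and> dist u v \<le> r}"
  shows "l \<le> discrete_coreness r x A"
proof -
  define E where "E = {{u, v} |u v. u \<in> S \<and> v \<in> S \<and> u \<noteq> v \<and> dist u v \<le> r}"
  have finS: "finite S"
    using fin S(1) by (meson finite_insert finite_subset)
  have sub: "is_subgraph (S, E) (neighborhood_graph r x A)"
    using S unfolding is_subgraph_def neighborhood_graph_def E_def by fastforce
  have "l \<le> graph_degree (S, E) v" if "v \<in> S" for v
  proof -
    have "{u. u \<noteq> v \<and> {u, v} \<in> E} = {u \<in> S. u \<noteq> v \<and> dist u v \<le> r}"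
      using that by (auto simp: E_def doubleton_eq_iff dist_commute)
    moreover have "graph_degree (S, E) v = card {u. u \<noteq> v \<and> {u, v} \<in> E}"
      unfolding graph_degree_def snd_conv
      by (rule card_neighbours_eq_card_edges) (auto simp: E_def)
    ultimately show ?thesis using deg[OF that] by simp
  qed
  hence "l \<le> Min (graph_degree (S, E) ` S)"
    using finS S(2) by (subst Min_ge_iff) auto
  hence "l \<in> core_levels r x A"
    unfolding core_levels_def using sub S(2) by force
  thus ?thesis
    unfolding discrete_coreness_def using finite_core_levels[OF fin] by (rule Max_ge[rotated])
qed

lemma discrete_coreness_witness:
  fixes x :: "'a::metric_space"
  assumes fin: "finite A"
  obtains V where "V \<subseteq> insert x A" "x \<in> V"
    "\<And>v. v \<in> V \<Longrightarrow> discrete_coreness r x A \<le> card {u \<in> V. u \<noteq> v \<and> dist u v \<le> r}"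
proof -
  have "discrete_coreness r x A \<in> core_levels r x A"
    unfolding discrete_coreness_def
    using finite_core_levels[OF fin] zero_in_core_levels[of r x A] by (intro Max_in) auto
  then obtain H where H: "is_subgraph H (neighborhood_graph r x A)" "x \<in> fst H"
      "discrete_coreness r x A \<le> Min (graph_degree H ` fst H)"
    by (auto simp: core_levels_def)
  have V: "fst H \<subseteq> insert x A"
    using H(1) by (auto simp: is_subgraph_def neighborhood_graph_def)
  hence finV: "finite (fst H)"
    using fin by (meson finite_insert finite_subset)
  have edge: "\<exists>u w. e = {u, w} \<and> u \<noteq> w \<and> dist u w \<le> r \<and> u \<in> fst H \<and> w \<in> fst H"
    if "e \<in> snd H" for e
  proof -
    have "e \<in> {{u, v} |u v. u \<in> insert x A \<and> v \<in> insert x A \<and> u \<noteq> v \<and> dist u v \<le> r}"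
      "e \<subseteq> fst H"
      using H(1) that by (auto simp: is_subgraph_def neighborhood_graph_def)
    thus ?thesis by blast
  qed
  show thesis
  proof (rule that[OF V H(2)])
    fix v assume v: "v \<in> fst H"
    have "discrete_coreness r x A \<le> graph_degree H v"
      using H(3) finV v by (meson Min_le finite_imageI imageI order_trans)
    also have "\<dots> = card {u. u \<noteq> v \<and> {u, v} \<in> snd H}"
      unfolding graph_degree_def
      by (rule card_neighbours_eq_card_edges) (use edge in blast)
    also have "\<dots> \<le> card {u \<in> fst H. u \<noteq> v \<and> dist u v \<le> r}"
    proof (rule card_mono)
      show "{u. u \<noteq> v \<and> {u, v} \<in> snd H} \<subseteq> {u \<in> fst H. u \<noteq> v \<and> dist u v \<le> r}"
      proof clarify
        fix u assume u: "u \<noteq> v" "{u, v} \<in> snd H"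
        obtain a b where "{u, v} = {a, b}" "dist a b \<le> r" "a \<in> fst H" "b \<in> fst H"
          using edge[OF u(2)] by blast
        thus "u \<in> fst H \<and> u \<noteq> v \<and> dist u v \<le> r"
          using u(1) by (auto simp: doubleton_eq_iff dist_commute)
      qed
    qed (use finV in simp)
    finally show "discrete_coreness r x A \<le> card {u \<in> fst H. u \<noteq> v \<and> dist u v \<le> r}" .
  qed
qed

section \<open>Empirical frequencies\<close>

text \<open>Counts indices, not points: repeated points count with multiplicity, as in an
  average of i.i.d. indicators. The index starts at \<open>1\<close>, like the samples \<open>X\<^sub>1, X\<^sub>2, \<dots>\<close>.\<close>

definition freq :: "(nat \<Rightarrow> 'a) \<Rightarrow> nat \<Rightarrow> 'a set \<Rightarrow> real" where
  "freq p n B = real (card {i \<in> {1..n}. p i \<in> B}) / real n"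

lemma freq_mono: "B \<subseteq> B' \<Longrightarrow> freq p n B \<le> freq p n B'"
  unfolding freq_def by (intro divide_right_mono of_nat_mono card_mono) auto

lemma card_points_le_freq: "real (card (p ` {1..n} \<inter> B)) \<le> real n * freq p n B"
proof -
  have "card (p ` {1..n} \<inter> B) \<le> card {i \<in> {1..n}. p i \<in> B}"
    by (rule surj_card_le[where f = p]) auto
  thus ?thesis by (auto simp: freq_def)
qed

lemma card_points_eq_freq:
  assumes "inj_on p {1..n}"
  shows "real (card (p ` {1..n} \<inter> B)) = real n * freq p n B"
proof -
  have "p ` {1..n} \<inter> B = p ` {i \<in> {1..n}. p i \<in> B}" by auto
  hence "card (p ` {1..n} \<inter> B) = card {i \<in> {1..n}. p i \<in> B}"
    using assms by (metis (no_types, lifting) card_image inj_on_subset mem_Collect_eq subsetI)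
  thus ?thesis by (auto simp: freq_def)
qed

text \<open>The strong law of large numbers for indicators. Hoeffding's inequality bounds the probability of a
  deviation \<open>e\<close> at time \<open>n\<close> by a geometric sequence in \<open>n\<close>, so Borel-Cantelli applies for
  each \<open>e = 1 / (m + 1)\<close>.\<close>

lemma (in prob_space) AE_freq_tendsto:
  fixes X :: "nat \<Rightarrow> 'a \<Rightarrow> 'b"
  assumes ind: "indep_vars (\<lambda>_. N) X {1..}"
    and distr: "\<And>i. i \<ge> 1 \<Longrightarrow> distr M N (X i) = P" and A [measurable]: "A \<in> sets N"
  shows "AE \<xi> in M. (\<lambda>n. freq (\<lambda>i. X i \<xi>) n A) \<longlonglongrightarrow> measure P A"
proof -
  have X: "X i \<in> measurable M N" if "i \<ge> 1" for i
    using ind that by (auto simp: indep_vars_def)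
  define Y :: "nat \<Rightarrow> 'a \<Rightarrow> real" where "Y i \<xi> = indicator A (X i \<xi>)" for i \<xi>
  have Y [measurable]: "Y i \<in> borel_measurable M" if "i \<ge> 1" for i
    unfolding Y_def using X[OF that] by measurable
  have indY: "indep_vars (\<lambda>_. borel) Y {1..}"
    unfolding Y_def by (rule indep_vars_compose2[OF ind]) auto
  have distrY: "distr M borel (Y i) = distr P borel (indicator A)" if "i \<ge> 1" for i
    unfolding distr[OF that, symmetric] Y_def
    using X[OF that] by (subst distr_distr) (auto simp: o_def)
  have mu: "expectation (Y 1) = measure P A"
  proof -
    have "expectation (Y 1) = measure M (X 1 -` A \<inter> space M)"
      by (subst Bochner_Integration.integral_cong[where g = "indicator (X 1 -` A \<inter> space M)"])
         (auto simp: Y_def indicator_def)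
    thus ?thesis using distr[of 1] X[of 1] by (auto simp: measure_distr)
  qed
  have freq_eq: "freq (\<lambda>i. X i \<xi>) n A = (\<Sum>i\<in>{1..n}. Y i \<xi>) / real n" for \<xi> n
    by (auto simp: freq_def Y_def indicator_def sum.If_cases Int_def)
  define B where "B e n = {\<xi> \<in> space M. \<bar>(\<Sum>i\<in>{1..n}. Y i \<xi>) / real n - measure P A\<bar> \<ge> e}" for e n
  have B_sets: "B e n \<in> sets M" for e n
  proof -
    have "(\<lambda>\<xi>. \<Sum>i\<in>{1..n}. Y i \<xi>) \<in> borel_measurable M"
      by (intro borel_measurable_sum Y) auto
    thus ?thesis unfolding B_def by measurable
  qed
  have B_prob: "prob (B e n) \<le> 2 * exp (- 2 * e\<^sup>2) ^ n" if "e > 0" "n \<ge> 1" for e n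
  proof -
    interpret H: Hoeffding_ineq_iid M "{1..n}" Y "Y 1" 0 1 "expectation (Y 1)"
    proof unfold_locales
      show "indep_vars (\<lambda>_. borel) Y {1..n}"
        by (rule indep_vars_subset[OF indY]) auto
      show "AE x in M. Y 1 x \<in> {0..1}" by (auto simp: Y_def indicator_def)
    qed (auto simp: distrY)
    have "prob (B e n) \<le> 2 * exp (- 2 * real n * e\<^sup>2)"
      using H.Hoeffding_ineq_abs_ge'[of e] that unfolding B_def mu by simp
    also have "exp (- 2 * real n * e\<^sup>2) = exp (- 2 * e\<^sup>2) ^ n"
      by (simp add: exp_of_nat_mult[symmetric] mult_ac)
    finally show ?thesis .
  qed
  have "AE \<xi> in M. eventually (\<lambda>n. \<xi> \<in> space M - B (1 / Suc m) n) sequentially" for m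
  proof (rule borel_cantelli_AE1[OF B_sets])
    have "summable (\<lambda>n. 2 * exp (- 2 * (1 / real (Suc m))\<^sup>2) ^ n)"
      by (intro summable_mult summable_geometric) simp
    thus "summable (\<lambda>n. prob (B (1 / Suc m) n))"
      by (rule summable_comparison_test'[where N = 1]) (use B_prob[of "1 / Suc m"] in auto)
  qed (simp add: emeasure_eq_measure)
  hence "AE \<xi> in M. \<forall>m. eventually (\<lambda>n. \<xi> \<in> space M - B (1 / Suc m) n) sequentially"
    by (simp add: AE_all_countable)
  thus ?thesis
  proof eventually_elim
    case (elim \<xi>)
    show ?case
    proof (rule tendstoI)
      fix e :: real assume "e > 0"
      then obtain m where m: "1 / real (Suc m) < e"
        using reals_Archimedean[of e] by (auto simp: inverse_eq_divide)
      from elim have "eventually (\<lambda>n. \<xi> \<in> space M - B (1 / Suc m) n) sequentially" by blast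
      thus "eventually (\<lambda>n. dist (freq (\<lambda>i. X i \<xi>) n A) (measure P A) < e) sequentially"
      proof eventually_elim
        case (elim n)
        hence "\<bar>freq (\<lambda>i. X i \<xi>) n A - measure P A\<bar> < 1 / real (Suc m)"
          by (auto simp: B_def freq_eq)
        thus ?case using m by (simp add: dist_real_def)
      qed
    qed
  qed
qed

text \<open>For two indices the joint law is a product measure; by Fubini it gives the diagonal the integral
  of the mass of points, which is zero. Distinctness makes counts of sample points equal to counts of
  indices.\<close>

lemma (in prob_space) AE_inj_of_indep_nonatomic:
  fixes X :: "nat \<Rightarrow> 'a \<Rightarrow> 'b::euclidean_space"
  assumes ind: "indep_vars (\<lambda>_. borel) X I"
    and atoms: "\<And>i y. i \<in> I \<Longrightarrow> emeasure (distr M borel (X i)) {y} = 0"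
  shows "AE \<xi> in M. inj_on (\<lambda>i. X i \<xi>) I"
proof -
  have X: "X i \<in> borel_measurable M" if "i \<in> I" for i
    using ind that by (auto simp: indep_vars_def)
  have "AE \<xi> in M. X i \<xi> \<noteq> X j \<xi>" if ij: "i \<in> I" "j \<in> I" "i \<noteq> j" for i j
  proof -
    have "indep_var borel ((\<lambda>g. g i) \<circ> (\<lambda>\<xi>. restrict (\<lambda>i. X i \<xi>) {i}))
                    borel ((\<lambda>g. g j) \<circ> (\<lambda>\<xi>. restrict (\<lambda>i. X i \<xi>) {j}))"
      by (rule indep_var_compose[OF indep_var_restrict[OF ind]])
         (use ij in \<open>auto intro!: measurable_component_singleton\<close>)
    hence "indep_var borel (X i) borel (X j)"
      by (simp add: o_def)
    hence eq: "distr M borel (X i) \<Otimes>\<^sub>M distr M borel (X j) =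
               distr M (borel \<Otimes>\<^sub>M borel) (\<lambda>\<xi>. (X i \<xi>, X j \<xi>))"
      by (simp add: indep_var_distribution_eq)
    interpret J: prob_space "distr M borel (X j)"
      by (rule prob_space_distr[OF X[OF ij(2)]])
    let ?D = "{p :: 'b \<times> 'b. fst p = snd p}"
    have "closed ?D"
      by (intro closed_Collect_eq continuous_intros)
    hence D: "?D \<in> sets (borel \<Otimes>\<^sub>M borel)"
      unfolding borel_prod by (rule borel_closed)
    have [measurable]: "(\<lambda>\<xi>. (X i \<xi>, X j \<xi>)) \<in> measurable M (borel \<Otimes>\<^sub>M borel)"
      using X ij by auto
    have "emeasure (distr M borel (X i) \<Otimes>\<^sub>M distr M borel (X j)) ?D =
          (\<integral>\<^sup>+x. emeasure (distr M borel (X j)) (Pair x -` ?D) \<partial>distr M borel (X i))"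
      by (rule J.emeasure_pair_measure_alt) (use D in \<open>simp cong: sets_pair_measure_cong\<close>)
    also have "(\<lambda>x. Pair x -` ?D) = (\<lambda>x. {x})" by auto
    hence "\<And>x. Pair x -` ?D = {x}" by meson
    hence "(\<integral>\<^sup>+x. emeasure (distr M borel (X j)) (Pair x -` ?D) \<partial>distr M borel (X i)) = 0"
      by (simp add: atoms[OF ij(2)])
    finally have "emeasure M ((\<lambda>\<xi>. (X i \<xi>, X j \<xi>)) -` ?D \<inter> space M) = 0"
      unfolding eq using D by (simp add: emeasure_distr)
    hence "(\<lambda>\<xi>. (X i \<xi>, X j \<xi>)) -` ?D \<inter> space M \<in> null_sets M"
      using D by (intro null_setsI measurable_sets[of _ M]) auto
    thus ?thesis by (rule AE_I') auto
  qed
  hence "AE \<xi> in M. \<forall>i\<in>I. \<forall>j\<in>I. i \<noteq> j \<longrightarrow> X i \<xi> \<noteq> X j \<xi>"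
    by (auto simp: AE_ball_countable)
  thus ?thesis
    by eventually_elim (auto simp: inj_on_def)
qed

section \<open>Finite enclosures of the balls of a fixed radius\<close>

text \<open>\<open>Q\<close> is a finite set of brackets, in the sense of empirical process theory, for the class of all
  closed balls of radius \<open>r\<close>. The lower ends \<open>L\<close> may be empty, as they are for balls far from
  the origin.\<close>

definition ball_brackets :: "'a::metric_space measure \<Rightarrow> real \<Rightarrow> real \<Rightarrow> ('a set \<times> 'a set) set \<Rightarrow> bool"
  where "ball_brackets P r e Q \<longleftrightarrow> finite Q \<and>
    (\<forall>(L, U)\<in>Q. L \<in> sets P \<and> U \<in> sets P \<and> measure P (U - L) < e) \<and>
    (\<forall>x. \<exists>(L, U)\<in>Q. L \<subseteq> cball x r \<and> cball x r \<subseteq> U)"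

lemma ball_bracketsD:
  assumes "ball_brackets P r e Q"
  shows "finite Q"
    and "(L, U) \<in> Q \<Longrightarrow> L \<in> sets P" "(L, U) \<in> Q \<Longrightarrow> U \<in> sets P"
    and "(L, U) \<in> Q \<Longrightarrow> measure P (U - L) < e"
  using assms by (auto simp: ball_brackets_def)

lemma ball_bracketsE:
  assumes "ball_brackets P r e Q"
  obtains L U where "(L, U) \<in> Q" "L \<subseteq> cball x r" "cball x r \<subseteq> U"
proof -
  obtain b where "b \<in> Q" "case b of (L, U) \<Rightarrow> L \<subseteq> cball x r \<and> cball x r \<subseteq> U"
    using assms unfolding ball_brackets_def by blast
  thus thesis using that[of "fst b" "snd b"] by (simp add: case_prod_beta)
qed

lemma shell_measure_tendsto_sphere:
  fixes P :: "'a::euclidean_space measure"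
  assumes "finite_measure P" "sets P = sets borel"
  shows "(\<lambda>k. measure P (cball x (r + 1 / Suc k) - cball x (r - 1 / Suc k)))
           \<longlonglongrightarrow> measure P (sphere x r)"
proof -
  interpret finite_measure P by fact
  let ?S = "\<lambda>k. cball x (r + 1 / Suc k) - cball x (r - 1 / Suc k)"
  have dec: "decseq ?S"
  proof (intro decseq_SucI)
    fix k
    have "1 / real (Suc (Suc k)) \<le> 1 / real (Suc k)" by (simp add: frac_le)
    thus "?S (Suc k) \<subseteq> ?S k" by auto
  qed
  have "?S k \<in> sets P" for k
    unfolding assms(2) by (intro sets.Diff borel_closed closed_cball)
  hence "range ?S \<subseteq> sets P" by (rule image_subsetI)
  hence "(\<lambda>k. measure P (?S k)) \<longlonglongrightarrow> measure P (\<Inter>k. ?S k)"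
    using dec by (rule finite_Lim_measure_decseq)
  moreover have "(\<Inter>k. ?S k) = sphere x r"
  proof (intro equalityI subsetI)
    fix y assume y: "y \<in> (\<Inter>k. ?S k)"
    have lim: "(\<lambda>k. c + 1 / real (Suc k)) \<longlonglongrightarrow> c" "(\<lambda>k. c - 1 / real (Suc k)) \<longlonglongrightarrow> c" for c
      using tendsto_add[OF tendsto_const LIMSEQ_inverse_real_of_nat, of c]
        tendsto_diff[OF tendsto_const LIMSEQ_inverse_real_of_nat, of c]
      by (simp_all add: inverse_eq_divide)
    have "dist x y \<le> r"
    proof (rule LIMSEQ_le_const[OF lim(1)], intro exI allI impI)
      fix k show "dist x y \<le> r + 1 / real (Suc k)"
        using INT_D[OF y UNIV_I, of k] by simp
    qed
    moreover have "r \<le> dist x y"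
    proof (rule LIMSEQ_le_const2[OF lim(2)], intro exI allI impI)
      fix k show "r - 1 / real (Suc k) \<le> dist x y"
        using INT_D[OF y UNIV_I, of k] by simp
    qed
    ultimately show "y \<in> sphere x r" by auto
  qed auto
  ultimately show ?thesis by simp
qed

text \<open>Balls far from the origin lie between \<open>{}\<close> and the complement of a large ball, whose measure is
  small. The remaining centres form a compact set. There the ball around a centre near \<open>x\<close> lies
  between two balls around \<open>x\<close> of radii \<open>r - d\<close> and \<open>r + d\<close>, and the shell between them is
  of small measure when \<open>d\<close> is small, because the sphere is null; finitely many \<open>x\<close> suffice.\<close>

lemma ball_brackets_exist:
  fixes P :: "'a::euclidean_space measure"
  assumes "finite_measure P" and sets: "sets P = sets borel"
    and sphere: "\<And>x. measure P (sphere x r) = 0" and "e > 0"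
  obtains Q where "ball_brackets P r e Q"
proof -
  interpret finite_measure P by fact
  have [simp]: "space P = UNIV" using sets_eq_imp_space_eq[OF sets] by simp
  have "(\<lambda>k. measure P (- cball (0::'a) (real k))) \<longlonglongrightarrow> measure P (\<Inter>k. - cball (0::'a) (real k))"
    by (rule finite_Lim_measure_decseq) (auto simp: sets intro!: decseq_SucI)
  moreover have "(\<Inter>k. - cball (0::'a) (real k)) = {}"
    by (auto simp: not_le) (meson not_less real_arch_simple)
  ultimately have "eventually (\<lambda>k. measure P (- cball (0::'a) (real k)) < e) sequentially"
    using \<open>e > 0\<close> by (intro order_tendstoD) auto
  then obtain R where R: "measure P (- cball (0::'a) (real R)) < e"
    by (auto simp: eventually_sequentially)
  have "\<exists>d>0. measure P (cball x (r + d) - cball x (r - d)) < e" for x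
  proof -
    have "eventually (\<lambda>k. measure P (cball x (r + 1 / Suc k) - cball x (r - 1 / Suc k)) < e) sequentially"
      by (rule order_tendstoD[OF shell_measure_tendsto_sphere[OF assms(1,2)]])
         (use sphere \<open>e > 0\<close> in simp)
    then obtain k where "measure P (cball x (r + 1 / Suc k) - cball x (r - 1 / Suc k)) < e"
      by (auto simp: eventually_sequentially)
    thus ?thesis by (intro exI[of _ "1 / Suc k"]) simp
  qed
  hence "\<exists>d. \<forall>x. d x > 0 \<and> measure P (cball x (r + d x) - cball x (r - d x)) < e"
    by (intro choice) auto
  then obtain d where d: "\<And>x. d x > 0" "\<And>x. measure P (cball x (r + d x) - cball x (r - d x)) < e"
    by blast
  obtain T where T: "finite T" "cball (0::'a) (real R + r) \<subseteq> (\<Union>x\<in>T. ball x (d x))"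
  proof -
    have "cball (0::'a) (real R + r) \<subseteq> (\<Union>x. ball x (d x))"
    proof
      fix x :: 'a
      have "x \<in> ball x (d x)" using d(1) by simp
      thus "x \<in> (\<Union>x. ball x (d x))" by blast
    qed
    from compactE_image[OF compact_cball open_ball this] show thesis
      using that by metis
  qed
  define Q where
    "Q = insert ({}, - cball 0 (real R)) ((\<lambda>x. (cball x (r - d x), cball x (r + d x))) ` T)"
  have "\<exists>(L, U)\<in>Q. L \<subseteq> cball y r \<and> cball y r \<subseteq> U" for y
  proof (cases "y \<in> cball 0 (real R + r)")
    case True
    then obtain x where x: "x \<in> T" "dist x y < d x" using T(2) by auto
    have "cball x (r - d x) \<subseteq> cball y r" "cball y r \<subseteq> cball x (r + d x)"
    proof -
      show "cball x (r - d x) \<subseteq> cball y r"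
      proof
        fix z assume "z \<in> cball x (r - d x)"
        thus "z \<in> cball y r" using x(2) dist_triangle[of y z x] by (auto simp: dist_commute)
      qed
      show "cball y r \<subseteq> cball x (r + d x)"
      proof
        fix z assume "z \<in> cball y r"
        thus "z \<in> cball x (r + d x)" using x(2) dist_triangle[of x z y] by (auto simp: dist_commute)
      qed
    qed
    thus ?thesis using x(1) unfolding Q_def by blast
  next
    case False
    have "cball y r \<subseteq> - cball 0 (real R)"
    proof
      fix z assume "z \<in> cball y r"
      thus "z \<in> - cball 0 (real R)"
        using False dist_triangle[of 0 y z] by (auto simp: dist_commute)
    qed
    thus ?thesis unfolding Q_def by blast
  qed
  hence "ball_brackets P r e Q"
    unfolding ball_brackets_def using T(1) R d(2) by (auto simp: Q_def sets)
  thus thesis by (rule that)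
qed

text \<open>The Glivenko-Cantelli argument: by monotonicity, the frequency and the measure of
  \<open>cball x r \<inter> A\<close> lie between those of \<open>L \<inter> A\<close> and \<open>U \<inter> A\<close>. Hence an error
  below \<open>e / 2\<close> at the finitely many bracket ends, together with brackets of measure below
  \<open>e / 2\<close>, gives an error below \<open>e\<close> at every \<open>x\<close>.\<close>

lemma uniform_freq_of_brackets:
  fixes P :: "'a::euclidean_space measure"
  assumes "finite_measure P" and A: "A \<in> sets P" and sets: "sets P = sets borel"
    and Q: "\<And>m. ball_brackets P r (1 / real (Suc m)) (Q m)"
    and lim: "\<And>m L U. (L, U) \<in> Q m \<Longrightarrow>
      (\<lambda>n. freq p n (L \<inter> A)) \<longlonglongrightarrow> measure P (L \<inter> A) \<and>
      (\<lambda>n. freq p n (U \<inter> A)) \<longlonglongrightarrow> measure P (U \<inter> A)"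
  shows "uniform_limit UNIV (\<lambda>n x. freq p n (cball x r \<inter> A)) (\<lambda>x. measure P (cball x r \<inter> A)) sequentially"
proof (rule uniform_limitI)
  interpret finite_measure P by fact
  fix e :: real assume "e > 0"
  then obtain m where m: "1 / real (Suc m) < e / 2"
    using reals_Archimedean[of "e / 2"] by (auto simp: inverse_eq_divide)
  have "eventually (\<lambda>n. \<forall>b\<in>Q m. \<bar>freq p n (fst b \<inter> A) - measure P (fst b \<inter> A)\<bar> < e / 2 \<and>
          \<bar>freq p n (snd b \<inter> A) - measure P (snd b \<inter> A)\<bar> < e / 2) sequentially"
  proof (intro eventually_ball_finite ball_bracketsD(1)[OF Q] ballI eventually_conj)
    fix b assume b: "b \<in> Q m"
    have "e / 2 > 0" using \<open>e > 0\<close> by simp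
    have l: "(\<lambda>n. freq p n (fst b \<inter> A)) \<longlonglongrightarrow> measure P (fst b \<inter> A)"
      "(\<lambda>n. freq p n (snd b \<inter> A)) \<longlonglongrightarrow> measure P (snd b \<inter> A)"
      using lim[of "fst b" "snd b" m] b by auto
    show "eventually (\<lambda>n. \<bar>freq p n (fst b \<inter> A) - measure P (fst b \<inter> A)\<bar> < e / 2) sequentially"
      "eventually (\<lambda>n. \<bar>freq p n (snd b \<inter> A) - measure P (snd b \<inter> A)\<bar> < e / 2) sequentially"
      by (rule tendstoD[OF l(1) \<open>e / 2 > 0\<close>, unfolded dist_real_def]
          tendstoD[OF l(2) \<open>e / 2 > 0\<close>, unfolded dist_real_def])+
  qed
  thus "eventually (\<lambda>n. \<forall>x\<in>UNIV. dist (freq p n (cball x r \<inter> A)) (measure P (cball x r \<inter> A)) < e) sequentially"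
  proof eventually_elim
    case (elim n)
    show ?case
    proof
      fix x
      obtain L U where LU: "(L, U) \<in> Q m" "L \<subseteq> cball x r" "cball x r \<subseteq> U"
        using ball_bracketsE[OF Q] .
      note S = ball_bracketsD(2-4)[OF Q LU(1)]
      have "measure P (U \<inter> A) \<le> measure P (L \<inter> A) + measure P (U - L)"
      proof -
        have "measure P (U \<inter> A) \<le> measure P (L \<inter> A \<union> (U - L))"
          using S A by (intro finite_measure_mono) auto
        also have "\<dots> \<le> measure P (L \<inter> A) + measure P (U - L)"
          using S A by (intro measure_Un_le) auto
        finally show ?thesis .
      qed
      moreover have "cball x r \<in> sets P"
        unfolding sets by (intro borel_closed closed_cball)
      hence "measure P (L \<inter> A) \<le> measure P (cball x r \<inter> A)"
        and "measure P (cball x r \<inter> A) \<le> measure P (U \<inter> A)"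
        using LU(2,3) S(2) A by (auto intro!: finite_measure_mono)
      moreover have "freq p n (L \<inter> A) \<le> freq p n (cball x r \<inter> A)"
        "freq p n (cball x r \<inter> A) \<le> freq p n (U \<inter> A)"
        using LU by (auto intro!: freq_mono)
      moreover have "\<bar>freq p n (L \<inter> A) - measure P (L \<inter> A)\<bar> < e / 2"
        "\<bar>freq p n (U \<inter> A) - measure P (U \<inter> A)\<bar> < e / 2"
        using bspec[OF elim LU(1)] by simp_all
      ultimately show "dist (freq p n (cball x r \<inter> A)) (measure P (cball x r \<inter> A)) < e"
        unfolding dist_real_def using less_trans[OF S(3) m] by linarith
    qed
  qed
qed

lemma (in prob_space) AE_uniform_freq:
  fixes X :: "nat \<Rightarrow> 'a \<Rightarrow> 'b::euclidean_space" and P :: "'b measure"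
  assumes ind: "indep_vars (\<lambda>_. borel) X {1..}"
    and distr: "\<And>i. i \<ge> 1 \<Longrightarrow> distr M borel (X i) = P"
    and sphere: "\<And>x. measure P (sphere x r) = 0" and A: "A \<in> sets borel"
  shows "AE \<xi> in M. uniform_limit UNIV (\<lambda>n x. freq (\<lambda>i. X i \<xi>) n (cball x r \<inter> A))
           (\<lambda>x. measure P (cball x r \<inter> A)) sequentially"
proof -
  have sets: "sets P = sets borel"
    unfolding distr[OF order_refl, symmetric] by (rule sets_distr)
  have "X 1 \<in> borel_measurable M" using ind by (auto simp: indep_vars_def)
  hence "prob_space P"
    unfolding distr[OF order_refl, symmetric] by (rule prob_space_distr)
  then interpret P: prob_space P .
  have "\<exists>Q. ball_brackets P r (1 / real (Suc m)) Q" for m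
    by (rule ball_brackets_exist[OF P.finite_measure_axioms sets sphere, of "1 / real (Suc m)"])
       auto
  then obtain Q where Q: "\<And>m. ball_brackets P r (1 / real (Suc m)) (Q m)" by metis
  have "AE \<xi> in M. \<forall>m. \<forall>b\<in>Q m.
      (\<lambda>n. freq (\<lambda>i. X i \<xi>) n (fst b \<inter> A)) \<longlonglongrightarrow> measure P (fst b \<inter> A) \<and>
      (\<lambda>n. freq (\<lambda>i. X i \<xi>) n (snd b \<inter> A)) \<longlonglongrightarrow> measure P (snd b \<inter> A)"
    unfolding AE_all_countable
  proof (intro allI AE_ball_countable[THEN iffD2] countable_finite ball_bracketsD(1)[OF Q] ballI AE_conjI)
    fix m b assume b: "b \<in> Q m"
    have "fst b \<in> sets borel" "snd b \<in> sets borel"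
      using ball_bracketsD(2,3)[OF Q, of "fst b" "snd b" m] b sets by auto
    thus "AE \<xi> in M. (\<lambda>n. freq (\<lambda>i. X i \<xi>) n (fst b \<inter> A)) \<longlonglongrightarrow> measure P (fst b \<inter> A)"
      "AE \<xi> in M. (\<lambda>n. freq (\<lambda>i. X i \<xi>) n (snd b \<inter> A)) \<longlonglongrightarrow> measure P (snd b \<inter> A)"
      using A by (auto intro!: AE_freq_tendsto[OF ind distr])
  qed
  thus ?thesis
  proof eventually_elim
    case (elim \<xi>)
    show ?case
    proof (rule uniform_freq_of_brackets[OF P.finite_measure_axioms _ sets Q])
      fix m L U assume "(L, U) \<in> Q m"
      with elim show "(\<lambda>n. freq (\<lambda>i. X i \<xi>) n (L \<inter> A)) \<longlonglongrightarrow> measure P (L \<inter> A) \<and>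
        (\<lambda>n. freq (\<lambda>i. X i \<xi>) n (U \<inter> A)) \<longlonglongrightarrow> measure P (U \<inter> A)" by fastforce
    qed (use A sets in auto)
  qed
qed

section \<open>Continuum coreness\<close>

locale coreness_density =
  fixes r :: real and f :: "'a::euclidean_space \<Rightarrow> real"
  assumes nonneg: "0 \<le> f x" and integrable: "integrable lborel f"
    and total: "(LINT x|lborel. f x) = 1" and r_pos: "r > 0"
begin

definition P :: "'a measure" where "P = density lborel (\<lambda>x. ennreal (f x))"

text \<open>Converts \<open>P\<close>-mass of balls into averages; \<open>n / c\<close> is the normalisation of the
  discrete coreness.\<close>

definition c :: real where "c = 1 / (unit_ball_volume TYPE('a) * r ^ DIM('a))"

abbreviation \<phi> :: "nat \<Rightarrow> 'a \<Rightarrow> real" where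
  "\<phi> k \<equiv> (H_op r f ^^ k) (ball_average r f)"

abbreviation core :: "'a \<Rightarrow> real" where "core \<equiv> continuum_coreness r f"

lemma f_measurable: "f \<in> borel_measurable lborel"
  using integrable by (rule borel_measurable_integrable)

lemma sets_P [measurable_cong]: "sets P = sets borel"
  by (simp add: P_def)

lemma emeasure_P:
  assumes "A \<in> sets borel"
  shows "emeasure P A = ennreal (LINT z|lborel. indicator A z * f z)"
proof -
  have "emeasure P A = (\<integral>\<^sup>+x. ennreal (indicator A x * f x) \<partial>lborel)"
    unfolding P_def using assms f_measurable
    by (subst emeasure_density) (auto intro!: nn_integral_cong simp: indicator_def)
  also have "\<dots> = ennreal (LINT z|lborel. indicator A z * f z)"
    using integrable_mult_indicator[of A lborel f] assms integrable
    by (intro nn_integral_eq_integral) (auto simp: nonneg)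
  finally show ?thesis .
qed

lemma measure_P: "A \<in> sets borel \<Longrightarrow> measure P A = (LINT z|lborel. indicator A z * f z)"
  using emeasure_P[of A] by (auto simp: measure_def nonneg intro!: integral_nonneg_AE)

sublocale P: prob_space P
proof
  show "emeasure P (space P) = 1"
    using emeasure_P[of UNIV] total by (simp add: P_def)
qed

lemma P_null:
  assumes "N \<in> null_sets lborel"
  shows "N \<in> null_sets P"
  using f_measurable AE_not_in[OF assms] null_setsD2[OF assms]
  by (auto simp: P_def null_sets_density_iff)

lemma P_sphere: "measure P (sphere x \<rho>) = 0"
proof -
  have "sphere x \<rho> \<in> null_sets lborel"
    using negligible_sphere[of x \<rho>]
    by (auto simp: null_sets_completion_iff negligible_iff_null_sets)
  thus ?thesis by (intro measure_eq_0_null_sets P_null)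
qed

lemma unit_ball_volume_pos: "unit_ball_volume TYPE('a) > 0"
  unfolding unit_ball_volume_def by (simp add: content_cball)

lemma c_pos: "c > 0"
  using unit_ball_volume_pos r_pos by (simp add: c_def)

lemma ball_average_indicator:
  assumes "A \<in> sets borel"
  shows "ball_average r (\<lambda>z. indicator A z * f z) x = c * measure P (cball x r \<inter> A)"
proof -
  have "cball x r \<inter> A \<in> sets borel" using assms by auto
  thus ?thesis
    by (simp add: ball_average_def measure_P set_lebesgue_integral_def indicator_inter_arith
        mult.assoc flip: c_def)
qed

lemma ball_average_eq: "ball_average r f x = c * measure P (cball x r)"
  using ball_average_indicator[of UNIV x] by simp

lemmas density_assms = integrable nonneg r_pos

lemma \<phi>_measurable: "\<phi> k \<in> borel_measurable borel"
  using H_op_iterate_measurable[OF density_assms] .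

lemma \<phi>_tendsto: "(\<lambda>k. \<phi> k x) \<longlonglongrightarrow> core x"
  using continuum_coreness_limit[OF density_assms] .

lemma core_measurable: "core \<in> borel_measurable borel"
  by (rule borel_measurable_LIMSEQ_real[OF \<phi>_tendsto \<phi>_measurable])

lemma level_sets: "g \<in> borel_measurable borel \<Longrightarrow> {z. t \<le> g z} \<in> sets borel" for g :: "'a \<Rightarrow> real"
  by measurable

lemma \<phi>_decseq: "decseq (\<lambda>k. \<phi> k x)"
  by (rule decseq_SucI) (rule H_op_iterate_Suc_le[OF density_assms])

lemma core_le_\<phi>: "core x \<le> \<phi> k x"
  by (rule decseq_ge[OF \<phi>_decseq \<phi>_tendsto])

lemma \<phi>_nonneg: "0 \<le> \<phi> k x"
proof -
  have "0 \<le> \<phi> (Suc k) x" using H_op_nonneg[OF density_assms \<phi>_measurable] by simp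
  also have "\<dots> \<le> \<phi> k x" by (rule H_op_iterate_Suc_le[OF density_assms])
  finally show ?thesis .
qed

lemma core_nonneg: "0 \<le> core x"
  by (rule LIMSEQ_le_const[OF \<phi>_tendsto]) (use \<phi>_nonneg in blast)

lemma core_le_c: "core x \<le> c"
  using core_le_\<phi>[of x 0] c_pos by (simp add: ball_average_eq mult_left_le order_trans)

lemma H_op_eq:
  assumes "g \<in> borel_measurable borel"
  shows "H_op r f g x = Sup {t. 0 \<le> t \<and> t \<le> c * measure P (cball x r \<inter> {z. t \<le> g z})}"
  by (simp add: H_op_def ball_average_indicator[OF level_sets[OF assms]])

text \<open>\<open>H_op r f g x\<close> is the point where the nonincreasing function \<open>t \<mapsto> c P(B(x, r) \<inter> {g \<ge> t})\<close> crosses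
  the diagonal. The next lemmas turn this into an introduction and a destruction rule; the latter is
  stated for levels strictly below \<open>H_op r f g x\<close>, at which attainment of the supremum is not an
  issue.\<close>

lemma level_mass_antimono:
  fixes g :: "'a \<Rightarrow> real"
  assumes "g \<in> borel_measurable borel" "s \<le> t"
  shows "c * measure P (cball x r \<inter> {z. t \<le> g z}) \<le> c * measure P (cball x r \<inter> {z. s \<le> g z})"
proof -
  have "cball x r \<inter> {z. s \<le> g z} \<in> sets P" for s
    using level_sets[OF assms(1)] by (auto simp: sets_P)
  thus ?thesis
    using assms(2) c_pos by (intro mult_left_mono P.finite_measure_mono) auto
qed

lemma bdd_above_H_op_levels:
  "bdd_above {t. 0 \<le> t \<and> t \<le> c * measure P (cball x r \<inter> {z. t \<le> g z})}"
proof (rule bdd_aboveI[of _ c])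
  fix t assume t: "t \<in> {t. 0 \<le> t \<and> t \<le> c * measure P (cball x r \<inter> {z. t \<le> g z})}"
  have "c * measure P (cball x r \<inter> {z. t \<le> g z}) \<le> c * 1"
    using c_pos by (intro mult_left_mono) auto
  thus "t \<le> c" using t by simp
qed

lemma le_H_opI:
  assumes "g \<in> borel_measurable borel" "0 \<le> t"
    "t \<le> c * measure P (cball x r \<inter> {z. t \<le> g z})"
  shows "t \<le> H_op r f g x"
  unfolding H_op_eq[OF assms(1)] using assms
  by (intro cSup_upper bdd_above_H_op_levels) auto

lemma less_H_opD:
  assumes "g \<in> borel_measurable borel" "s < H_op r f g x"
  shows "s \<le> c * measure P (cball x r \<inter> {z. s \<le> g z})"
proof -
  let ?T = "{t. 0 \<le> t \<and> t \<le> c * measure P (cball x r \<inter> {z. t \<le> g z})}"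
  have "0 \<in> ?T" using c_pos by simp
  then obtain t where "s < t" "t \<in> ?T"
    using assms(2) less_cSupD[of ?T s] unfolding H_op_eq[OF assms(1)] by blast
  thus ?thesis
    using level_mass_antimono[OF assms(1), of s t x] by auto
qed

text \<open>Half of the fixed point property of the coreness. For \<open>s < t \<le> core x\<close> each iterate exceeds \<open>s\<close> at
  \<open>x\<close>, so the set \<open>{\<phi> k \<ge> s}\<close> has normalised mass at least \<open>s\<close> in the ball. These sets decrease to
  \<open>{core \<ge> s}\<close> as \<open>k \<rightarrow> \<infinity>\<close>, and then \<open>{core \<ge> s}\<close> decreases to \<open>{core \<ge> t}\<close> as \<open>s \<longrightarrow> t\<close>; both times
  the bound survives by continuity of the measure from above.\<close>

lemma core_level_self_dense:
  assumes "t \<le> core x"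
  shows "t \<le> c * measure P (cball x r \<inter> {z. t \<le> core z})"
proof -
  (* Finite intersections make the sequence decreasing whatever u and g are, so that both limits
     below are instances of a single statement. *)
  have lim: "(\<lambda>n. c * measure P (\<Inter>i\<le>n. cball x r \<inter> {z. u i \<le> g i z}))
    \<longlonglongrightarrow> c * measure P (\<Inter>i. cball x r \<inter> {z. u i \<le> g i z})"
    if "\<And>i. g i \<in> borel_measurable borel" for u :: "nat \<Rightarrow> real" and g :: "nat \<Rightarrow> 'a \<Rightarrow> real"
  proof -
    have "cball x r \<inter> {z. u i \<le> g i z} \<in> sets P" for i
      using level_sets[OF that] by (auto simp: sets_P)
    hence "range (\<lambda>n. \<Inter>i\<le>n. cball x r \<inter> {z. u i \<le> g i z}) \<subseteq> sets P"
      by (intro image_subsetI sets.finite_INT) auto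
    moreover have "decseq (\<lambda>n. \<Inter>i\<le>n. cball x r \<inter> {z. u i \<le> g i z})"
      by (intro decseq_SucI INT_anti_mono) auto
    ultimately have "(\<lambda>n. measure P (\<Inter>i\<le>n. cball x r \<inter> {z. u i \<le> g i z}))
        \<longlonglongrightarrow> measure P (\<Inter>n. \<Inter>i\<le>n. cball x r \<inter> {z. u i \<le> g i z})"
      by (rule P.finite_Lim_measure_decseq)
    moreover have "(\<Inter>n. \<Inter>i\<le>n. cball x r \<inter> {z. u i \<le> g i z}) = (\<Inter>i. cball x r \<inter> {z. u i \<le> g i z})"
      by auto
    ultimately show ?thesis by (intro tendsto_mult tendsto_const) simp
  qed
  have below: "s \<le> c * measure P (cball x r \<inter> {z. s \<le> core z})" if "s < t" for s
  proof (rule LIMSEQ_le_const)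
    have "(\<Inter>k. cball x r \<inter> {z. s \<le> \<phi> k z}) = cball x r \<inter> {z. s \<le> core z}"
      using LIMSEQ_le_const[OF \<phi>_tendsto] core_le_\<phi> order_trans by fastforce
    with lim[of \<phi> "\<lambda>_. s", OF \<phi>_measurable]
    show "(\<lambda>n. c * measure P (\<Inter>k\<le>n. cball x r \<inter> {z. s \<le> \<phi> k z}))
        \<longlonglongrightarrow> c * measure P (cball x r \<inter> {z. s \<le> core z})" by simp
    have "s \<le> c * measure P (\<Inter>k\<le>n. cball x r \<inter> {z. s \<le> \<phi> k z})" for n
    proof -
      have "(\<Inter>k\<le>n. cball x r \<inter> {z. s \<le> \<phi> k z}) = cball x r \<inter> {z. s \<le> \<phi> n z}"
        using decseqD[OF \<phi>_decseq] order_trans by fastforce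
      moreover have "s < H_op r f (\<phi> n) x"
        using that assms core_le_\<phi>[of x "Suc n"] by simp
      ultimately show ?thesis using less_H_opD[OF \<phi>_measurable] by simp
    qed
    thus "\<exists>N. \<forall>n\<ge>N. s \<le> c * measure P (\<Inter>k\<le>n. cball x r \<inter> {z. s \<le> \<phi> k z})" by blast
  qed
  have inv: "(\<lambda>n. t - 1 / real (Suc n)) \<longlonglongrightarrow> t"
    using tendsto_diff[OF tendsto_const LIMSEQ_inverse_real_of_nat, of t]
    by (simp add: inverse_eq_divide)
  show ?thesis
  proof (rule LIMSEQ_le[OF inv])
    have "(\<Inter>n. cball x r \<inter> {z. t - 1 / real (Suc n) \<le> core z}) = cball x r \<inter> {z. t \<le> core z}"
      (is "?L = ?R")
    proof
      show "?L \<subseteq> ?R"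
      proof
        fix z assume z: "z \<in> ?L"
        have "t \<le> core z"
          by (rule LIMSEQ_le_const2[OF inv]) (use z in blast)
        thus "z \<in> ?R" using z by blast
      qed
      show "?R \<subseteq> ?L"
      proof
        fix z assume z: "z \<in> ?R"
        have "t - 1 / real (Suc n) \<le> core z" for n
        proof -
          have "0 \<le> 1 / real (Suc n)" "t \<le> core z" using z by simp_all
          thus ?thesis by linarith
        qed
        thus "z \<in> ?L" using z by blast
      qed
    qed
    with lim[of "\<lambda>_. core" "\<lambda>n. t - 1 / real (Suc n)", OF core_measurable]
    show "(\<lambda>n. c * measure P (\<Inter>i\<le>n. cball x r \<inter> {z. t - 1 / real (Suc i) \<le> core z}))
        \<longlonglongrightarrow> c * measure P (cball x r \<inter> {z. t \<le> core z})" by simp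
    have "t - 1 / real (Suc n) \<le> c * measure P (\<Inter>i\<le>n. cball x r \<inter> {z. t - 1 / real (Suc i) \<le> core z})" for n
    proof -
      have le: "t - 1 / real (Suc i) \<le> t - 1 / real (Suc n)" if "i \<le> n" for i
        using that by (simp add: frac_le)
      have "(\<Inter>i\<le>n. cball x r \<inter> {z. t - 1 / real (Suc i) \<le> core z})
          = cball x r \<inter> {z. t - 1 / real (Suc n) \<le> core z}"
        using le order_trans by fastforce
      thus ?thesis using below[of "t - 1 / real (Suc n)"] by simp
    qed
    thus "\<exists>N. \<forall>n\<ge>N. t - 1 / real (Suc n) \<le> c * measure P (\<Inter>i\<le>n. cball x r \<inter> {z. t - 1 / real (Suc i) \<le> core z})"
      by blast
  qed
qed

lemma brackets_exist:
  assumes "e > 0"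
  obtains Q where "ball_brackets P r e Q"
  using ball_brackets_exist[OF P.finite_measure_axioms sets_P P_sphere assms] .

text \<open>The bound does not depend on \<open>g\<close>: passing from the ball at \<open>x\<close> to the one at \<open>y\<close> lowers the normalised
  mass of any set by at most \<open>c * e\<close>, and lowering a diagonal-crossing nonincreasing function by
  \<open>c * e\<close> moves the crossing by at most \<open>c * e\<close>.\<close>

lemma H_op_oscillation:
  assumes g: "g \<in> borel_measurable borel"
    and LU: "L \<in> sets P" "U \<in> sets P" "measure P (U - L) \<le> e"
    and "cball x r \<subseteq> U" "L \<subseteq> cball y r" and "e \<ge> 0"
  shows "H_op r f g x \<le> H_op r f g y + c * e"
proof -
  let ?m = "\<lambda>x t. c * measure P (cball x r \<inter> {z. t \<le> g z})"
  have S: "cball x r \<inter> {z. t \<le> g z} \<in> sets P" for x t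
    using level_sets[OF g] by (auto simp: sets_P)
  have shift: "?m x t \<le> ?m y t + c * e" for t
  proof -
    have "measure P (cball x r \<inter> {z. t \<le> g z}) \<le> measure P ((cball y r \<inter> {z. t \<le> g z}) \<union> (U - L))"
      using assms S by (intro P.finite_measure_mono) auto
    also have "\<dots> \<le> measure P (cball y r \<inter> {z. t \<le> g z}) + measure P (U - L)"
      using LU S by (intro measure_Un_le) auto
    finally have "measure P (cball x r \<inter> {z. t \<le> g z}) \<le> measure P (cball y r \<inter> {z. t \<le> g z}) + e"
      using LU(3) by linarith
    hence "?m x t \<le> c * (measure P (cball y r \<inter> {z. t \<le> g z}) + e)"
      using c_pos by (intro mult_left_mono) auto
    thus ?thesis by (simp add: algebra_simps)
  qed
  have "s \<le> H_op r f g y + c * e" if s: "s < H_op r f g x" for s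
  proof (cases "s - c * e \<le> 0")
    case True
    thus ?thesis using H_op_nonneg[OF density_assms g, of y] by linarith
  next
    case False
    have "s - c * e \<le> ?m y s"
      using less_H_opD[OF g s] shift[of s] by linarith
    also have "\<dots> \<le> ?m y (s - c * e)"
      using c_pos \<open>e \<ge> 0\<close> by (intro level_mass_antimono[OF g]) simp
    finally have "s - c * e \<le> H_op r f g y"
      using False by (intro le_H_opI[OF g]) auto
    thus ?thesis by linarith
  qed
  thus ?thesis by (rule dense_le)
qed

text \<open>As in Dini's theorem, monotone pointwise convergence becomes uniform through equicontinuity and
  compactness; here the brackets provide both. All iterates from the first one on, and therefore
  their limit, vary by at most \<open>e / 4\<close> between points that share a bracket, so it suffices to have
  convergence at one representative of each bracket.\<close>

lemma \<phi>_uniform_limit: "uniform_limit UNIV \<phi> core sequentially"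
proof (rule uniform_limitI)
  fix e :: real assume "e > 0"
  define d where "d = e / (4 * c)"
  have "d > 0" and cd: "c * d = e / 4" using \<open>e > 0\<close> c_pos by (simp_all add: d_def)
  obtain Q where Q: "ball_brackets P r d Q"
    using brackets_exist[OF \<open>d > 0\<close>] .
  (* A bracket that encloses no ball gets an arbitrary representative, which does no harm. *)
  define y where "y b = (SOME y. fst b \<subseteq> cball y r \<and> cball y r \<subseteq> snd b)" for b :: "'a set \<times> 'a set"
  have osc: "\<phi> (Suc k) x \<le> \<phi> (Suc k) x' + e / 4"
    if LU: "(L, U) \<in> Q" "cball x r \<subseteq> U" "L \<subseteq> cball x' r" for k x x' L U
  proof -
    have "measure P (U - L) \<le> d" using ball_bracketsD(4)[OF Q LU(1)] by simp
    from H_op_oscillation[OF \<phi>_measurable ball_bracketsD(2,3)[OF Q LU(1)] this LU(2,3)] \<open>d > 0\<close> cd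
    show ?thesis by simp
  qed
  have "eventually (\<lambda>k. \<forall>b\<in>Q. dist (\<phi> k (y b)) (core (y b)) < e / 4) sequentially"
    using \<open>e > 0\<close> by (intro eventually_ball_finite ball_bracketsD(1)[OF Q] ballI tendstoD[OF \<phi>_tendsto]) simp
  hence "eventually (\<lambda>k. k \<ge> 1 \<and> (\<forall>b\<in>Q. dist (\<phi> k (y b)) (core (y b)) < e / 4)) sequentially"
    by (intro eventually_conj eventually_ge_at_top)
  thus "eventually (\<lambda>k. \<forall>x\<in>UNIV. dist (\<phi> k x) (core x) < e) sequentially"
  proof eventually_elim
    case (elim k)
    then obtain j where k: "k = Suc j" by (cases k) auto
    show ?case
    proof
      fix x
      obtain L U where LU: "(L, U) \<in> Q" "L \<subseteq> cball x r" "cball x r \<subseteq> U"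
        using ball_bracketsE[OF Q] .
      have y: "L \<subseteq> cball (y (L, U)) r" "cball (y (L, U)) r \<subseteq> U"
        using someI[of "\<lambda>y. L \<subseteq> cball y r \<and> cball y r \<subseteq> U" x] LU(2,3) by (auto simp: y_def)
      have "\<phi> k x \<le> \<phi> k (y (L, U)) + e / 4"
        unfolding k by (rule osc[OF LU(1,3) y(1)])
      moreover have "dist (\<phi> k (y (L, U))) (core (y (L, U))) < e / 4"
        using elim LU(1) by blast
      moreover have "core (y (L, U)) \<le> core x + e / 4"
      proof (rule LIMSEQ_le[OF \<phi>_tendsto[THEN LIMSEQ_Suc] tendsto_add[OF \<phi>_tendsto[THEN LIMSEQ_Suc] tendsto_const]])
        show "\<exists>N. \<forall>n\<ge>N. \<phi> (Suc n) (y (L, U)) \<le> \<phi> (Suc n) x + e / 4"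
          using osc[OF LU(1) y(2) LU(2)] by blast
      qed
      ultimately show "dist (\<phi> k x) (core x) < e"
        using core_le_\<phi>[of x k] \<open>e > 0\<close> unfolding dist_real_def by linarith
    qed
  qed
qed

end

section \<open>Comparison of the two corenesses\<close>

lemma finite_rational_grid:
  fixes e b :: real
  assumes "e > 0"
  obtains T where "finite T" "T \<subseteq> \<rat>" "\<forall>t\<in>T. 0 \<le> t"
    "\<forall>y\<in>{0..b}. \<exists>t\<in>T. t \<le> y \<and> y < t + e"
proof -
  obtain m where m: "1 / real (Suc m) < e"
    using reals_Archimedean[OF assms] by (auto simp: inverse_eq_divide)
  define T where "T = (\<lambda>i. real i / real (Suc m)) ` {..nat \<lfloor>b * real (Suc m)\<rfloor>}"
  show thesis
  proof (rule that, safe)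
    fix y assume "y \<in> {0..b}"
    hence y: "0 \<le> y" "y \<le> b" by auto
    define i where "i = nat \<lfloor>y * real (Suc m)\<rfloor>"
    have "y * real (Suc m) \<le> b * real (Suc m)"
      using y by (intro mult_right_mono) auto
    hence "i \<le> nat \<lfloor>b * real (Suc m)\<rfloor>"
      unfolding i_def by (intro nat_mono floor_mono)
    hence "real i / real (Suc m) \<in> T" by (auto simp: T_def)
    moreover have "real i \<le> y * real (Suc m)" "y * real (Suc m) < real i + 1"
    proof -
      have "0 \<le> y * real (Suc m)" using y by simp
      thus "real i \<le> y * real (Suc m)" "y * real (Suc m) < real i + 1"
        unfolding i_def by linarith+
    qed
    hence "real i / real (Suc m) \<le> y" "y < real i / real (Suc m) + 1 / real (Suc m)"
      by (simp_all add: field_simps)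
    ultimately show "\<exists>t\<in>T. t \<le> y \<and> y < t + e"
      using m by (intro bexI[of _ "real i / real (Suc m)"]) auto
  qed (auto simp: T_def)
qed

context coreness_density
begin

text \<open>A vertex set \<open>V\<close> that realises the coreness of \<open>x\<close> lies in \<open>{z. t \<le> \<phi> j z}\<close> for all \<open>j \<le> k\<close>, by
  induction on \<open>j\<close>: a member of \<open>V\<close> sees the other members inside the superlevel set reached so far.\<close>

lemma discrete_coreness_imp_\<phi>_ge:
  fixes p :: "nat \<Rightarrow> 'a"
  assumes "n \<ge> 1" "0 \<le> t"
    and ball: "\<And>y. freq p n (cball y r) \<le> measure P (cball y r) + \<delta>"
    and level: "\<And>j y. j < k \<Longrightarrow>
      freq p n (cball y r \<inter> {z. t \<le> \<phi> j z}) \<le> measure P (cball y r \<inter> {z. t \<le> \<phi> j z}) + \<delta>"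
    and big: "t + c * \<delta> \<le> c * ((real (discrete_coreness r x (p ` {1..n})) - 1) / real n)"
  shows "t \<le> \<phi> k x"
proof -
  let ?D = "discrete_coreness r x (p ` {1..n})"
  obtain V where V: "V \<subseteq> insert x (p ` {1..n})" "x \<in> V"
      "\<And>v. v \<in> V \<Longrightarrow> ?D \<le> card {u \<in> V. u \<noteq> v \<and> dist u v \<le> r}"
    using discrete_coreness_witness[of "p ` {1..n}" x r] by blast
  (* The 1 subtracted from the coreness pays for the vertex x, which may fail to be a sample point. *)
  have mass: "t \<le> c * m" if "v \<in> V" "V \<subseteq> W" "freq p n (cball v r \<inter> W) \<le> m + \<delta>" for v W m
  proof -
    have "?D \<le> card (insert x (p ` {1..n} \<inter> (cball v r \<inter> W)))"
      using V(1) that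
      by (intro order_trans[OF V(3)[OF that(1)]] card_mono) (auto simp: dist_commute)
    also have "\<dots> \<le> Suc (card (p ` {1..n} \<inter> (cball v r \<inter> W)))"
      by (rule card_insert_le_m1) auto
    finally have "real ?D - 1 \<le> real (card (p ` {1..n} \<inter> (cball v r \<inter> W)))" by linarith
    also have "\<dots> \<le> real n * freq p n (cball v r \<inter> W)" by (rule card_points_le_freq)
    also have "\<dots> \<le> real n * (m + \<delta>)" using that(3) by (intro mult_left_mono) auto
    finally have "(real ?D - 1) / real n \<le> m + \<delta>"
      using \<open>n \<ge> 1\<close> by (simp add: divide_le_eq mult.commute)
    hence "c * ((real ?D - 1) / real n) \<le> c * (m + \<delta>)"
      using c_pos by (intro mult_left_mono) auto
    thus ?thesis using big by (simp add: algebra_simps)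
  qed
  have "\<forall>v\<in>V. t \<le> \<phi> j v" if "j \<le> k" for j
    using that
  proof (induction j)
    case 0
    show ?case
      using mass[of _ UNIV] ball by (simp add: ball_average_eq)
  next
    case (Suc j)
    hence V_sub: "V \<subseteq> {z. t \<le> \<phi> j z}" and "j < k" by auto
    have "t \<le> H_op r f (\<phi> j) v" if "v \<in> V" for v
      by (rule le_H_opI[OF \<phi>_measurable \<open>0 \<le> t\<close> mass[OF that V_sub level[OF \<open>j < k\<close>]]])
    thus ?case by simp
  qed
  thus ?thesis using V(2) by blast
qed

text \<open>The sample points in \<open>{z. t \<le> core z}\<close> and \<open>x\<close> itself span a subgraph of large minimum degree, as that
  superlevel set is self-dense and frequencies approximate probabilities.\<close>

lemma core_ge_imp_discrete_coreness:
  fixes p :: "nat \<Rightarrow> 'a"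
  assumes inj: "inj_on p {1..n}" and "n \<ge> 1" and "t \<le> core x"
    and level: "\<And>y. measure P (cball y r \<inter> {z. t \<le> core z}) \<le> freq p n (cball y r \<inter> {z. t \<le> core z}) + \<delta>"
  shows "t - c * \<delta> - c / real n \<le> c * real (discrete_coreness r x (p ` {1..n})) / real n"
proof -
  let ?D = "discrete_coreness r x (p ` {1..n})"
  define S where "S = insert x (p ` {1..n} \<inter> {z. t \<le> core z})"
  define l where "l = nat \<lceil>real n * (t / c - \<delta>)\<rceil>"
  have "l - 1 \<le> ?D"
  proof (rule discrete_coreness_ge)
    fix v assume v: "v \<in> S"
    let ?N = "p ` {1..n} \<inter> (cball v r \<inter> {z. t \<le> core z})"
    have "t \<le> core v" using v \<open>t \<le> core x\<close> by (auto simp: S_def)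
    hence "t \<le> c * (freq p n (cball v r \<inter> {z. t \<le> core z}) + \<delta>)"
      using core_level_self_dense level[of v] c_pos
      by (meson less_imp_le mult_left_mono order_trans)
    hence "t / c - \<delta> \<le> freq p n (cball v r \<inter> {z. t \<le> core z})"
      using c_pos by (simp add: field_simps)
    hence "real n * (t / c - \<delta>) \<le> real n * freq p n (cball v r \<inter> {z. t \<le> core z})"
      by (intro mult_left_mono) auto
    also have "\<dots> = real (card ?N)"
      by (rule card_points_eq_freq[OF inj, symmetric])
    finally have "l \<le> card ?N" by (simp add: l_def ceiling_le_iff)
    (* v itself may be among the points counted, but it is not its own neighbour. *)
    hence "l - 1 \<le> card ?N - 1" by simp
    also have "\<dots> \<le> card (?N - {v})" using diff_card_le_card_Diff[of "{v}" ?N] by simp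
    also have "\<dots> \<le> card {u \<in> S. u \<noteq> v \<and> dist u v \<le> r}"
      by (rule card_mono) (auto simp: S_def dist_commute)
    finally show "l - 1 \<le> card {u \<in> S. u \<noteq> v \<and> dist u v \<le> r}" .
  qed (auto simp: S_def)
  moreover have "real n * (t / c - \<delta>) \<le> real l"
    unfolding l_def by linarith
  ultimately have "real n * (t / c - \<delta>) - 1 \<le> real ?D" by linarith
  hence "c / real n * (real n * (t / c - \<delta>) - 1) \<le> c / real n * real ?D"
    using c_pos by (intro mult_left_mono) auto
  moreover have "c / real n * (real n * (t / c - \<delta>) - 1) = t - c * \<delta> - c / real n"
    using c_pos \<open>n \<ge> 1\<close> by (simp add: field_simps)
  ultimately show ?thesis by simp
qed

lemma discrete_coreness_le:
  fixes p :: "nat \<Rightarrow> 'a"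
  shows "real (discrete_coreness r x (p ` {1..n})) - 1 \<le> real n"
proof -
  obtain V where V: "V \<subseteq> insert x (p ` {1..n})" "x \<in> V"
      "\<And>v. v \<in> V \<Longrightarrow> discrete_coreness r x (p ` {1..n}) \<le> card {u \<in> V. u \<noteq> v \<and> dist u v \<le> r}"
    using discrete_coreness_witness[of "p ` {1..n}" x r] by blast
  have "discrete_coreness r x (p ` {1..n}) \<le> card {u \<in> V. u \<noteq> x \<and> dist u x \<le> r}"
    by (rule V(3)[OF V(2)])
  also have "\<dots> \<le> card (p ` {1..n})"
    using V(1) by (intro card_mono) auto
  also have "\<dots> \<le> n" using card_image_le[of "{1..n}" p] by simp
  finally show ?thesis by linarith
qed

text \<open>The deterministic core of the theorem: it holds for every point sequence whose frequencies are
  uniformly close to the probabilities on the superlevel sets at rational levels.\<close>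

lemma coreness_uniform_limit:
  fixes p :: "nat \<Rightarrow> 'a"
  assumes inj: "inj_on p {1..}"
    and dev_\<phi>: "\<And>k q. q \<in> \<rat> \<Longrightarrow> uniform_limit UNIV
      (\<lambda>n x. freq p n (cball x r \<inter> {z. q \<le> \<phi> k z}))
      (\<lambda>x. measure P (cball x r \<inter> {z. q \<le> \<phi> k z})) sequentially"
    and dev_core: "\<And>q. q \<in> \<rat> \<Longrightarrow> uniform_limit UNIV
      (\<lambda>n x. freq p n (cball x r \<inter> {z. q \<le> core z}))
      (\<lambda>x. measure P (cball x r \<inter> {z. q \<le> core z})) sequentially"
  shows "uniform_limit UNIV
    (\<lambda>n x. c * real (discrete_coreness r x (p ` {1..n})) / real n) core sequentially"
proof (rule uniform_limitI)
  fix e' :: real assume "e' > 0"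
  (* Four errors e enter the upper bound: the frequencies, the grid, the approximation of core by
     the k-th iterate, and the vertex x, which contributes c / n. *)
  define e where "e = e' / 5"
  define \<delta> where "\<delta> = e / c"
  have "e > 0" "\<delta> > 0" and c\<delta>: "c * \<delta> = e"
    using \<open>e' > 0\<close> c_pos by (simp_all add: e_def \<delta>_def)
  obtain k where k: "\<And>x. dist (\<phi> k x) (core x) < e"
    using uniform_limitD[OF \<phi>_uniform_limit \<open>e > 0\<close>] by (auto simp: eventually_sequentially)
  obtain T where T: "finite T" "T \<subseteq> \<rat>" "\<forall>t\<in>T. 0 \<le> t"
    "\<forall>y\<in>{0..c}. \<exists>t\<in>T. t \<le> y \<and> y < t + e"
    using finite_rational_grid[OF \<open>e > 0\<close>, of c] .
  (* Level 0 of the zeroth iterate is the whole space. *)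
  have "eventually (\<lambda>n. \<forall>x. dist (freq p n (cball x r)) (measure P (cball x r)) < \<delta>) sequentially"
    using uniform_limitD[OF dev_\<phi>[of 0 0] \<open>\<delta> > 0\<close>] \<phi>_nonneg[of 0] by simp
  moreover have "eventually (\<lambda>n. \<forall>t\<in>T. \<forall>j\<in>{..<k}. \<forall>x\<in>UNIV.
      dist (freq p n (cball x r \<inter> {z. t \<le> \<phi> j z})) (measure P (cball x r \<inter> {z. t \<le> \<phi> j z})) < \<delta>) sequentially"
    by (intro eventually_ball_finite T(1) ballI uniform_limitD[OF dev_\<phi> \<open>\<delta> > 0\<close>])
       (use T(2) in auto)
  moreover have "eventually (\<lambda>n. \<forall>t\<in>T. \<forall>x\<in>UNIV.
      dist (freq p n (cball x r \<inter> {z. t \<le> core z})) (measure P (cball x r \<inter> {z. t \<le> core z})) < \<delta>) sequentially"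
    by (intro eventually_ball_finite T(1) ballI uniform_limitD[OF dev_core \<open>\<delta> > 0\<close>])
       (use T(2) in auto)
  moreover have "eventually (\<lambda>n. c / real n < e) sequentially"
    using \<open>e > 0\<close> by (intro order_tendstoD(2)[OF lim_const_over_n])
  moreover have "eventually (\<lambda>n::nat. n \<ge> 1) sequentially" by (rule eventually_ge_at_top)
  ultimately show "eventually (\<lambda>n. \<forall>x\<in>UNIV.
      dist (c * real (discrete_coreness r x (p ` {1..n})) / real n) (core x) < e') sequentially"
  proof eventually_elim
    case (elim n)
    show ?case
    proof
      fix x
      let ?D = "real (discrete_coreness r x (p ` {1..n}))"
      have "c * ?D / real n < core x + e'"
      proof -
        define y where "y = c * ((?D - 1) / real n) - c * \<delta>"
        have D: "c * ?D / real n = y + e + c / real n"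
          using c\<delta> elim(5) by (simp add: y_def field_simps)
        have "y \<le> core x + 2 * e"
        proof (cases "y \<ge> 0")
          case True
          have "c * ((?D - 1) / real n) \<le> c * 1"
            using discrete_coreness_le[of x p n] elim(5) c_pos
            by (intro mult_left_mono) (auto simp: divide_le_eq_1)
          hence "y \<le> c" using c\<delta> \<open>e > 0\<close> by (simp add: y_def)
          then obtain t where t: "t \<in> T" "t \<le> y" "y < t + e" using T(4) True by force
          have "t \<le> \<phi> k x"
          proof (rule discrete_coreness_imp_\<phi>_ge[OF elim(5) bspec[OF T(3) t(1)]])
            show "t + c * \<delta> \<le> c * ((?D - 1) / real n)" using t(2) by (simp add: y_def)
            show "freq p n (cball y r) \<le> measure P (cball y r) + \<delta>" for y
              using elim(1)[rule_format, of y] unfolding dist_real_def by linarith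
            show "freq p n (cball y r \<inter> {z. t \<le> \<phi> j z}) \<le> measure P (cball y r \<inter> {z. t \<le> \<phi> j z}) + \<delta>"
              if "j < k" for j y
              using elim(2)[rule_format, of t j y] t(1) that unfolding dist_real_def by auto
          qed
          thus ?thesis using k[of x] t(3) unfolding dist_real_def by linarith
        next
          case False
          thus ?thesis using core_nonneg[of x] \<open>e > 0\<close> by linarith
        qed
        thus ?thesis using D elim(4) \<open>e > 0\<close> unfolding e_def by linarith
      qed
      moreover have "core x - e' < c * ?D / real n"
      proof -
        obtain t where t: "t \<in> T" "t \<le> core x" "core x < t + e"
          using bspec[OF T(4), of "core x"] core_nonneg core_le_c by auto
        have "t - c * \<delta> - c / real n \<le> c * ?D / real n"
        proof (rule core_ge_imp_discrete_coreness[OF inj_on_subset[OF inj] elim(5) t(2)])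
          show "measure P (cball y r \<inter> {z. t \<le> core z}) \<le> freq p n (cball y r \<inter> {z. t \<le> core z}) + \<delta>" for y
            using elim(3)[rule_format, of t y] t(1) unfolding dist_real_def by auto
        qed auto
        thus ?thesis using c\<delta> elim(4) t(3) \<open>e > 0\<close> unfolding e_def by linarith
      qed
      ultimately show "dist (c * ?D / real n) (core x) < e'"
        unfolding dist_real_def by linarith
    qed
  qed
qed

end

theorem theorem3p5:
  fixes M :: "'w measure"
    and X :: "nat \<Rightarrow> 'w \<Rightarrow> 'a::euclidean_space"
    and f :: "'a \<Rightarrow> real"
    and r :: real
  assumes "prob_space M"
    and "\<And>x. 0 \<le> f x"
    and "integrable lborel f"
    and "(LINT x|lborel. f x) = 1"
    and "uniformly_continuous_on UNIV f"
    and "prob_space.indep_vars M (\<lambda>_. borel) X {1..}"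
    and "\<And>i. i \<ge> 1 \<Longrightarrow> distributed M lborel (X i) (\<lambda>x. ennreal (f x))"
    and "r > 0"
  shows "AE \<xi> in M.
           uniform_limit UNIV
             (\<lambda>n x. real (discrete_coreness r x ((\<lambda>i. X i \<xi>) ` {1..n}))
                      / (real n * unit_ball_volume TYPE('a) * r ^ DIM('a)))
             (\<lambda>x. continuum_coreness r f x)
             sequentially"
proof -
  interpret prob_space M by fact
  interpret coreness_density r f
    by unfold_locales (use assms in auto)
  note ind = assms(6)
  have distr: "distr M borel (X i) = P" if "i \<ge> 1" for i
    using distributed_distr_eq_density[OF assms(7)[OF that]]
    unfolding P_def by (metis distr_cong sets_lborel)
  have uniform: "AE \<xi> in M. uniform_limit UNIV (\<lambda>n x. freq (\<lambda>i. X i \<xi>) n (cball x r \<inter> {z. q \<le> g z}))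
      (\<lambda>x. measure P (cball x r \<inter> {z. q \<le> g z})) sequentially"
    if "g \<in> borel_measurable borel" for g :: "'a \<Rightarrow> real" and q
    by (rule AE_uniform_freq[OF ind distr P_sphere level_sets[OF that]])
  have "AE \<xi> in M. inj_on (\<lambda>i. X i \<xi>) {1..}"
  proof (rule AE_inj_of_indep_nonatomic[OF ind])
    show "emeasure (distr M borel (X i)) {y} = 0" if "i \<in> {1..}" for i y
      using P_null[OF finite_imp_null_set_lborel, of "{y}"] distr[of i] that
      by (simp add: null_setsD1)
  qed
  moreover have "AE \<xi> in M. \<forall>k. \<forall>q\<in>\<rat>. uniform_limit UNIV
      (\<lambda>n x. freq (\<lambda>i. X i \<xi>) n (cball x r \<inter> {z. q \<le> \<phi> k z}))
      (\<lambda>x. measure P (cball x r \<inter> {z. q \<le> \<phi> k z})) sequentially"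
    unfolding AE_all_countable
    by (intro allI AE_ball_countable[THEN iffD2] countable_rat ballI uniform \<phi>_measurable)
  moreover have "AE \<xi> in M. \<forall>q\<in>\<rat>. uniform_limit UNIV
      (\<lambda>n x. freq (\<lambda>i. X i \<xi>) n (cball x r \<inter> {z. q \<le> core z}))
      (\<lambda>x. measure P (cball x r \<inter> {z. q \<le> core z})) sequentially"
    by (intro AE_ball_countable[THEN iffD2] countable_rat ballI uniform core_measurable)
  ultimately show ?thesis
  proof eventually_elim
    case (elim \<xi>)
    have "uniform_limit UNIV
        (\<lambda>n x. c * real (discrete_coreness r x ((\<lambda>i. X i \<xi>) ` {1..n})) / real n) core sequentially"
      by (rule coreness_uniform_limit) (use elim in auto)
    moreover have "c * real D / real n = real D / (real n * unit_ball_volume TYPE('a) * r ^ DIM('a))"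
      for D n
      by (simp add: c_def mult_ac)
    ultimately show ?case by simp
  qed
qed

end
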